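(* For every $M>0$ there exist a time $T_*=T_*(M)\in(0,\infty)$ and a $C^1$ function $x\colon[0,T_* )\to(0,\infty)$ such that all of the following hold: (i) $x(0)=M$; (ii) for all $t\in[0,T_* )$, $$\dot x(t)\ \leq\ x(t)+x(t)^2\exp\left(\int_0^t x(s)\,ds\right);$$ (iii) $\limsup_{t\to T_*^-}x(t)=\infty$; (iv) there exists a sequence $(t_n)_{n\ge 0}$ in $[0,T_* )$ with $t_n\to T_*^-$ as $n\to\infty$ such that $x(t_n)=\frac{M}{n+1}$ for every $n\geq 0$.
   Context: $\dot x$ denotes the derivative of $x$ (one-sided at $t=0$). *)

theory Defs
  imports "HOL-Analysis.Analysis"
begin

end

theory Submission
  imports Defs "HOL-Real_Asymp.Real_Asymp"
begin

text \<open>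
  Take \<open>w = \<integral>\<^sub>0\<^sup>t x\<close> as the new time and put \<open>y = 1 / x\<close> as a function of \<open>w\<close>. Then \<open>dt/dw = y\<close>, so
  \<open>t = F w\<close> with \<open>F' = y\<close>, the blow-up time is \<open>T = \<integral>\<^sub>0\<^sup>\<infinity> y\<close>, and since \<open>x' = - y' / y\<^sup>3\<close> the
  differential inequality follows from \<open>- y' \<le> e\<^sup>w y\<close>. The function
  \<open>y w = (1 + w) / (M (1 + e\<^sup>w sin\<^sup>2(\<pi>w) / 5))\<close> satisfies this because \<open>1 + \<pi> < 5\<close>. It equals
  \<open>(n + 1) / M\<close> at the integers and tends to 0 along the half-integers, and it is integrable
  because its peak at \<open>n\<close> has height of order \<open>n\<close> and width of order \<open>e\<^bsup>-n/2\<^esup>\<close>.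
\<close>

section \<open>Primitives and inversion of the time change\<close>

lemma exists_primitive_greaterThan:
  fixes y :: "real \<Rightarrow> real"
  assumes "continuous_on {c..} y"
  obtains F where "F a = 0" "\<And>w. c < w \<Longrightarrow> (F has_real_derivative y w) (at w)"
proof (rule that[of "\<lambda>w. integral {c..w} y - integral {c..a} y"])
  let ?F = "\<lambda>w. integral {c..w} y - integral {c..a} y"
  show "?F a = 0" by simp
  show "(?F has_real_derivative y w) (at w)" if w: "c < w" for w
  proof -
    have "continuous_on {c..w+1} y"
      by (rule continuous_on_subset[OF assms(1)]) auto
    hence "((\<lambda>w. integral {c..w} y) has_real_derivative y w) (at w within {c..w+1})"
      using w by (intro integral_has_real_derivative) auto
    hence "((\<lambda>w. integral {c..w} y) has_real_derivative y w) (at w)"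
      using w at_within_Icc_at[of c w "w+1"] by simp
    thus ?thesis
      by (auto intro!: derivative_eq_intros)
  qed
qed

text \<open>The solution is \<open>x t = 1 / y (W t)\<close> with \<open>W\<close> the inverse of
  \<open>F\<close>. Then \<open>x\<close> is the derivative of \<open>W\<close>, so \<open>W\<close>
  recovers the integral of \<open>x\<close>. Since \<open>c < 0\<close>, the time 0 is the image of
  an interior point, and all derivatives there can be taken two-sided.\<close>

lemma time_change:
  fixes y y' F :: "real \<Rightarrow> real"
  assumes c: "c < 0"
    and pos: "\<And>w. c < w \<Longrightarrow> y w > 0"
    and dy: "\<And>w. c < w \<Longrightarrow> (y has_real_derivative y' w) (at w)"
    and cy': "continuous_on {c<..} y'"
    and ineq: "\<And>w. 0 \<le> w \<Longrightarrow> - y' w \<le> exp w * y w"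
    and F0: "F 0 = 0"
    and dF: "\<And>w. c < w \<Longrightarrow> (F has_real_derivative y w) (at w)"
    and bdd: "bdd_above (F ` {0..})"
  obtains T x x' where "T > 0"
    "\<And>t. t \<in> {0..<T} \<Longrightarrow> x t > 0"
    "\<And>t. t \<in> {0..<T} \<Longrightarrow> (x has_real_derivative x' t) (at t)"
    "continuous_on {0..<T} x'"
    "\<And>t. t \<in> {0..<T} \<Longrightarrow> x' t \<le> (x t)\<^sup>2 * exp (integral {0..t} x)"
    "\<And>w. w \<ge> 0 \<Longrightarrow> F w \<in> {0..<T}"
    "\<And>w. w \<ge> 0 \<Longrightarrow> x (F w) = 1 / y w"
    "filterlim F (at_left T) at_top"
proof -
  define T where "T = Sup (F ` {0..})"
  define W where "W = the_inv_into {c<..} F"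
  have mono: "F u < F v" if "c < u" "u < v" for u v
  proof (rule DERIV_pos_imp_increasing[OF that(2)])
    fix w assume "u \<le> w"
    hence "c < w" using that by simp
    thus "\<exists>d. (F has_real_derivative d) (at w) \<and> 0 < d" using pos dF by blast
  qed
  have inj: "inj_on F {c<..}"
    by (rule linorder_inj_onI) (use mono in force)+
  have WF: "W (F w) = w" if "c < w" for w
    unfolding W_def using inj that by (intro the_inv_into_f_f) auto
  have contF: "isCont F w" if "c < w" for w
    using dF[OF that] DERIV_isCont by blast
  have le_T: "F w \<le> T" if "0 \<le> w" for w
    unfolding T_def using bdd that by (intro cSup_upper) auto
  \<comment> \<open>The supremum is not attained, because \<open>F\<close> still grows between
    \<open>w\<close> and \<open>w+1\<close>.\<close>
  have less_T: "F w < T" if "0 \<le> w" for w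
    using mono[of w "w+1"] le_T[of "w+1"] that c by auto
  have nonneg: "0 \<le> F w" if "0 \<le> w" for w
    using mono[of 0 w] F0 that c by (cases "w = 0") auto
  have above: "\<exists>v\<ge>0. t < F v" if "t < T" for t
    using that less_cSup_iff[OF _ bdd, of t] unfolding T_def by auto
  have surj: "\<exists>w\<ge>0. t = F w" if t: "t \<in> {0..<T}" for t
  proof -
    obtain v where v: "v \<ge> 0" "t < F v" using above[of t] t by auto
    have "\<exists>w\<ge>0. w \<le> v \<and> F w = t"
      using v t F0 c contF by (intro IVT) auto
    thus ?thesis by auto
  qed
  have dW: "(W has_real_derivative 1 / y w) (at (F w))" if "c < w" for w
  proof -
    \<comment> \<open>Inverse function theorem on the open ray: it asks for continuity of
      \<open>F\<close> there and for \<open>W\<close> to be a left inverse.\<close>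
    have "(W has_derivative (\<lambda>t. t / y w)) (at (F w))"
    proof (rule has_derivative_inverse_strong[where S = "{c<..}" and f = F and f' = "\<lambda>h. y w * h"])
      show "continuous_on {c<..} F"
        using contF by (auto intro!: continuous_at_imp_continuous_on)
      show "(F has_derivative (\<lambda>h. y w * h)) (at w)"
        using dF[OF that] by (simp add: has_field_derivative_def)
      show "(\<lambda>h. y w * h) \<circ> (\<lambda>t. t / y w) = id"
        using pos[OF that] by (auto simp: fun_eq_iff)
    qed (use that WF in auto)
    moreover have "(\<lambda>t. t / y w) = (*) (1 / y w)" by auto
    ultimately show ?thesis by (simp add: has_field_derivative_def)
  qed
  define x where "x = (\<lambda>t. 1 / y (W t))"
  define x' where "x' = (\<lambda>t. - y' (W t) / (y (W t)) ^ 3)"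
  show ?thesis
  proof
    show "T > 0" using less_T[of 0] F0 by simp
    show "F w \<in> {0..<T}" if "w \<ge> 0" for w using that nonneg less_T by auto
    show xF: "x (F w) = 1 / y w" if "w \<ge> 0" for w
      unfolding x_def using WF that c by simp
    show "x t > 0" if "t \<in> {0..<T}" for t
      using surj[OF that] xF pos c by fastforce
    have dWt: "(W has_real_derivative x t) (at t)" if t: "t \<in> {0..<T}" for t
      using surj[OF t] dW xF c by force
    show "(x has_real_derivative x' t) (at t)" if t: "t \<in> {0..<T}" for t
    proof -
      obtain w where w: "w \<ge> 0" "t = F w" using surj[OF t] by auto
      have cw: "c < w" using w c by simp
      have "((\<lambda>t. y (W t)) has_real_derivative y' w * (1 / y w)) (at t)"
        using DERIV_chain2[of y "y' w" W "F w" "1 / y w" UNIV] dy[OF cw] dW[OF cw] WF[OF cw] w by simp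
      from DERIV_inverse_fun[OF this] have "((\<lambda>t. inverse (y (W t))) has_real_derivative
          - (inverse (y w) * (y' w * (1 / y w)) * inverse (y w))) (at t)"
        using pos[OF cw] WF[OF cw] w by (simp add: mult_ac)
      moreover have "- (inverse (y w) * (y' w * (1 / y w)) * inverse (y w)) = x' t"
        using WF[OF cw] w by (simp add: x'_def field_simps power3_eq_cube)
      ultimately show ?thesis unfolding x_def by (simp add: inverse_eq_divide)
    qed
    have contW: "continuous_on {0..<T} W"
      using dWt DERIV_isCont by (intro continuous_at_imp_continuous_on) blast
    have W_mem: "W ` {0..<T} \<subseteq> {c<..}"
      using surj WF c by fastforce
    have "continuous_on {c<..} y"
      using dy DERIV_isCont by (intro continuous_at_imp_continuous_on) blast
    from continuous_on_compose2[OF this contW W_mem] continuous_on_compose2[OF cy' contW W_mem]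
    show "continuous_on {0..<T} x'"
      unfolding x'_def using pos W_mem by (intro continuous_intros) force+
    show "x' t \<le> (x t)\<^sup>2 * exp (integral {0..t} x)" if t: "t \<in> {0..<T}" for t
    proof -
      obtain w where w: "w \<ge> 0" "t = F w" using surj[OF t] by auto
      have cw: "c < w" using w c by simp
      \<comment> \<open>\<open>x\<close> is the derivative of \<open>W\<close> and
        \<open>W 0 = 0\<close>, so the integral in the exponent is exactly the new time
        \<open>w\<close>.\<close>
      have "(x has_integral W t - W 0) {0..t}"
      proof (rule fundamental_theorem_of_calculus)
        fix s assume "s \<in> {0..t}"
        hence "(W has_real_derivative x s) (at s)" using t by (intro dWt) auto
        thus "(W has_vector_derivative x s) (at s within {0..t})"
          using has_real_derivative_iff_has_vector_derivative has_vector_derivative_at_within by blast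
      qed (use t in auto)
      hence int: "integral {0..t} x = w"
        using WF[OF cw] WF[OF c] w F0 by (simp add: integral_unique)
      have "- y' w / (y w) ^ 3 \<le> exp w * y w / (y w) ^ 3"
        using ineq[OF w(1)] pos[OF cw] by (intro divide_right_mono) auto
      also have "\<dots> = (1 / y w)\<^sup>2 * exp w"
        using pos[OF cw] by (simp add: field_simps power3_eq_cube power2_eq_square)
      finally show ?thesis using int xF WF[OF cw] w by (simp add: x'_def)
    qed
    show "filterlim F (at_left T) at_top"
    proof (rule tendsto_imp_filterlim_at_left)
      show "(F \<longlongrightarrow> T) at_top"
      proof (rule increasing_tendsto)
        show "\<forall>\<^sub>F w in at_top. F w \<le> T"
          using eventually_ge_at_top[of 0] by eventually_elim (rule le_T)
        fix t assume "t < T"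
        then obtain v where v: "v \<ge> 0" "t < F v" using above by auto
        show "\<forall>\<^sub>F w in at_top. t < F w"
          using eventually_gt_at_top[of v]
        proof eventually_elim
          case (elim w)
          with mono[of v w] v c show ?case by simp
        qed
      qed
      show "\<forall>\<^sub>F w in at_top. F w < T"
        using eventually_ge_at_top[of 0] by eventually_elim (rule less_T)
    qed
  qed
qed

section \<open>The oscillating denominator\<close>

text \<open>Jordan's inequality: by concavity, sine lies above its chord from 0 to
  \<open>pi/2\<close>.\<close>

lemma sin_pi_mult_ge:
  assumes "0 \<le> v" "v \<le> 1/2"
  shows "2 * v \<le> sin (pi * v)"
proof -
  have "concave_on {0..pi} sin"
    by (rule f''_le0_imp_concave[where f' = cos and f'' = "\<lambda>x. - sin x"])
       (auto intro!: derivative_eq_intros sin_ge_zero)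
  from concave_onD[OF this, where t = "2 * v" and x = 0 and y = "pi/2"] assms show ?thesis
    by (simp add: mult.commute)
qed

lemma sin_pi_mult_sq_ge:
  assumes "\<bar>v\<bar> \<le> 1/2"
  shows "4 * v\<^sup>2 \<le> (sin (pi * v))\<^sup>2"
proof -
  have "2 * \<bar>v\<bar> \<le> sin (pi * \<bar>v\<bar>)" using assms by (intro sin_pi_mult_ge) auto
  hence "(2 * \<bar>v\<bar>)\<^sup>2 \<le> (sin (pi * \<bar>v\<bar>))\<^sup>2" by (intro power_mono) auto
  thus ?thesis by (auto simp: abs_if power_mult_distrib split: if_splits)
qed

lemma sin_pi_mult_diff_nat_sq: "(sin (pi * (w - real n)))\<^sup>2 = (sin (pi * w))\<^sup>2"
  by (simp add: right_diff_distrib sin_diff power_mult_distrib flip: power_mult)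

text \<open>The oscillating factor below \<open>1 + w\<close> in \<open>y\<close>: it returns to 1
  at every integer and is of order \<open>exp w\<close> at the half-integers.\<close>

definition denom :: "real \<Rightarrow> real"
  where "denom w = 1 + exp w * (sin (pi * w))\<^sup>2 / 5"

definition denom' :: "real \<Rightarrow> real"
  where "denom' w = exp w * ((sin (pi * w))\<^sup>2 + 2 * pi * sin (pi * w) * cos (pi * w)) / 5"

lemma denom_ge_1: "denom w \<ge> 1"
  by (simp add: denom_def)

lemma DERIV_denom: "(denom has_real_derivative denom' w) (at w)"
  unfolding denom_def denom'_def
  by (auto intro!: derivative_eq_intros simp: field_simps)

text \<open>This fixes the constant 5: the bracket in \<open>denom'\<close> is
  \<open>sin\<^sup>2(pi w) + pi sin(2 pi w)\<close>, at most \<open>1 + pi < 5\<close>. Together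
  with \<open>denom_ge_1\<close> it yields the differential inequality for \<open>y\<close>.\<close>

lemma denom'_le: "denom' w \<le> exp w"
proof -
  let ?s = "sin (pi * w)" and ?c = "cos (pi * w)"
  have "2 * ?s * ?c \<le> 1"
    using sin_double[of "pi * w"] sin_le_one[of "2 * (pi * w)"] by simp
  hence "pi * (2 * ?s * ?c) \<le> pi * 1" by (intro mult_left_mono) auto
  hence "pi * (2 * ?s * ?c) \<le> 4" using pi_less_4 by linarith
  hence "2 * pi * ?s * ?c \<le> 4" by (simp only: mult_ac)
  moreover have "?s\<^sup>2 \<le> 1" by (simp add: abs_square_le_1)
  ultimately have "?s\<^sup>2 + 2 * pi * ?s * ?c \<le> 1 + 4" by (intro add_mono)
  hence "exp w * (?s\<^sup>2 + 2 * pi * ?s * ?c) \<le> exp w * 5" by (intro mult_left_mono) auto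
  thus ?thesis by (simp add: denom'_def)
qed

lemma denom_nat: "denom (real n) = 1"
  by (simp add: denom_def mult.commute)

lemma denom_half: "denom (real n + 1/2) = 1 + exp (real n + 1/2) / 5"
  using sin_pi_mult_diff_nat_sq[of "real n + 1/2" n] by (simp add: denom_def)

text \<open>Write \<open>v = w - n\<close>. Then \<open>exp v \<ge> 1 + v \<ge> 1/2\<close> and
  \<open>sin\<^sup>2(pi w) \<ge> 4 v\<^sup>2\<close>, so the oscillating term is at least
  \<open>(2/5) exp(n) v\<^sup>2\<close>, and \<open>2/5 \<ge> 1/4\<close>. The form
  \<open>1 + (q v)\<^sup>2\<close> is chosen so that its reciprocal integrates to an
  arctangent.\<close>

lemma denom_ge:
  assumes "\<bar>w - real n\<bar> \<le> 1/2"
  shows "1 + (exp (real n / 2) / 2 * (w - real n))\<^sup>2 \<le> denom w"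
proof -
  define v where "v = w - real n"
  have "1/2 \<le> exp v"
    using exp_ge_add_one_self[of v] assms unfolding v_def by linarith
  hence "exp (real n) / 2 \<le> exp (real n) * exp v" by simp
  hence e: "exp (real n) / 2 \<le> exp w" by (simp add: v_def flip: exp_add)
  have "4 * v\<^sup>2 \<le> (sin (pi * w))\<^sup>2"
    using sin_pi_mult_sq_ge[of v] assms sin_pi_mult_diff_nat_sq[of w n] by (simp add: v_def)
  hence "exp (real n) / 2 * (4 * v\<^sup>2) \<le> exp w * (sin (pi * w))\<^sup>2"
    using e by (intro mult_mono) auto
  moreover have "(exp (real n / 2) / 2 * v)\<^sup>2 = exp (real n) * v\<^sup>2 / 4"
    by (simp add: power_mult_distrib power_divide flip: exp_double)
  moreover have "0 \<le> exp (real n) * v\<^sup>2" by simp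
  ultimately show ?thesis unfolding denom_def v_def by linarith
qed

section \<open>Finiteness of the blow-up time\<close>

text \<open>The line is cut into unit blocks centred at the integers, whose contributions have a
  summable bound. The first block begins at \<open>-1/2\<close>, so the domain must reach further
  left, while \<open>1 + w > 0\<close> requires staying right of \<open>-1\<close>;
  \<open>-3/4\<close> satisfies both.\<close>

lemma primitive_bounded:
  assumes dF: "\<And>w. -3/4 < w \<Longrightarrow> (F has_real_derivative (1 + w) / (M * denom w)) (at w)"
    and M: "M > (0::real)"
  shows "bdd_above (F ` {0..})"
proof -
  define b where "b n = 2 * pi * (real n + 2) / (M * exp (real n / 2))" for n :: nat
  have step: "F (real n + 1/2) - F (real n - 1/2) \<le> b n" for n
  proof -
    define q where "q = exp (real n / 2) / 2"
    have q: "q > 0" by (simp add: q_def)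
    \<comment> \<open>Primitive of a majorant of the integrand on block \<open>n\<close>: there
      \<open>1 + w \<le> n + 2\<close>, and \<open>denom_ge\<close> bounds the denominator below.
      The arctangent varies by at most \<open>pi\<close>, which gives \<open>b n\<close>.\<close>
    define G where "G w = (real n + 2) / (M * q) * arctan (q * (w - real n))" for w
    have "G (real n - 1/2) - F (real n - 1/2) \<le> G (real n + 1/2) - F (real n + 1/2)"
    proof (rule DERIV_nonneg_imp_nondecreasing[where f = "\<lambda>w. G w - F w"])
      fix w assume w: "real n - 1/2 \<le> w" "w \<le> real n + 1/2"
      have dG: "(G has_real_derivative (real n + 2) / (M * (1 + (q * (w - real n))\<^sup>2))) (at w)"
        unfolding G_def using q by (auto intro!: derivative_eq_intros simp: divide_inverse mult_ac)
      have "\<bar>w - real n\<bar> \<le> 1/2" using w by linarith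
      from denom_ge[OF this, folded q_def]
      have "(1 + w) / (M * denom w) \<le> (real n + 2) / (M * (1 + (q * (w - real n))\<^sup>2))"
        using w M
        by (intro frac_le mult_left_mono mult_pos_pos add_pos_nonneg) auto
      moreover have "((\<lambda>w. G w - F w) has_real_derivative
          (real n + 2) / (M * (1 + (q * (w - real n))\<^sup>2)) - (1 + w) / (M * denom w)) (at w)"
        using w by (intro DERIV_diff dG dF) auto
      ultimately show "\<exists>d. ((\<lambda>w. G w - F w) has_real_derivative d) (at w) \<and> 0 \<le> d"
        by (intro exI[of _ "(real n + 2) / (M * (1 + (q * (w - real n))\<^sup>2)) - (1 + w) / (M * denom w)"])
           simp
    qed simp
    hence "F (real n + 1/2) - F (real n - 1/2) \<le> G (real n + 1/2) - G (real n - 1/2)"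
      by simp
    also have "\<dots> = (real n + 2) / (M * q) * (arctan (q / 2) - arctan (- (q / 2)))"
      by (simp add: G_def right_diff_distrib)
    also have "\<dots> \<le> (real n + 2) / (M * q) * pi"
      using arctan_bounded[of "q/2"] M q unfolding arctan_minus by (intro mult_left_mono) auto
    also have "\<dots> = b n" by (simp add: b_def q_def)
    finally show ?thesis .
  qed
  have "summable b"
  proof (rule summable_comparison_test_bigo)
    show "summable (\<lambda>n. norm (1 / real n ^ 2))"
      using inverse_power_summable[of 2, where 'a = real] by (simp add: inverse_eq_divide)
    show "b \<in> O(\<lambda>n. 1 / real n ^ 2)"
      unfolding b_def using M by real_asymp
  qed
  moreover have "b n \<ge> 0" for n using M by (simp add: b_def)
  ultimately have b: "(\<Sum>n<N. b n) \<le> suminf b" for N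
    by (intro sum_le_suminf) auto
  have F_half: "F (real N - 1/2) \<le> F (-1/2) + (\<Sum>n<N. b n)" for N
  proof (induction N)
    case (Suc N)
    thus ?case using step[of N] by (simp add: algebra_simps)
  qed simp
  show ?thesis
  proof (rule bdd_aboveI2)
    fix w :: real assume "w \<in> {0..}"
    hence w: "0 \<le> w" by simp
    \<comment> \<open>Moves \<open>w\<close> up to a block boundary \<open>N - 1/2\<close>, where
      the telescoped bound applies.\<close>
    obtain N :: nat where N: "w + 1/2 \<le> real N" using real_arch_simple by blast
    have "F w \<le> F (real N - 1/2)"
    proof (rule DERIV_nonneg_imp_nondecreasing[where f = F])
      fix u assume "w \<le> u"
      with w M denom_ge_1[of u] show "\<exists>y. (F has_real_derivative y) (at u) \<and> 0 \<le> y"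
        by (intro exI[of _ "(1 + u) / (M * denom u)"] conjI dF) auto
    qed (use N in auto)
    also have "\<dots> \<le> F (-1/2) + suminf b" using F_half[of N] b[of N] by linarith
    finally show "F w \<le> F (-1/2) + suminf b" .
  qed
qed

section \<open>Unboundedness and assembly of the solution\<close>

text \<open>Any set that is eventual for \<open>F\<close> contains \<open>s k\<close> for all large
  \<open>k\<close>, where \<open>f\<close> exceeds every bound; hence each supremum in the infimum
  defining \<open>Limsup\<close> is infinite.\<close>

lemma Limsup_eq_PInf_sequence:
  fixes f :: "'a \<Rightarrow> real"
  assumes "filterlim s F sequentially" "filterlim (\<lambda>n. f (s n)) at_top sequentially"
  shows "Limsup F (\<lambda>t. ereal (f t)) = \<infinity>"
proof -
  have "(SUP t\<in>Collect P. ereal (f t)) = \<infinity>" if "eventually P F" for P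
  proof (rule SUP_PInfty)
    fix n :: nat
    have "\<forall>\<^sub>F k in sequentially. P (s k)"
      using assms(1) that by (simp add: filterlim_iff)
    moreover have "\<forall>\<^sub>F k in sequentially. real n \<le> f (s k)"
      using assms(2) by (simp add: filterlim_at_top)
    ultimately have "\<forall>\<^sub>F k in sequentially. P (s k) \<and> real n \<le> f (s k)"
      by eventually_elim simp
    from eventually_happens'[OF sequentially_bot this]
    show "\<exists>t\<in>Collect P. ereal (real n) \<le> ereal (f t)" by auto
  qed
  hence "\<infinity> \<le> Limsup F (\<lambda>t. ereal (f t))"
    unfolding Limsup_def by (intro INF_greatest) simp
  thus ?thesis by simp
qed

theorem theorem2p3:
  fixes M :: real
  assumes "M > 0"
  shows "\<exists>T::real. T > 0 \<and>
    (\<exists>(x::real \<Rightarrow> real) (x'::real \<Rightarrow> real).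
      (\<forall>t\<in>{0..<T}. x t > 0) \<and>
      (\<forall>t\<in>{0..<T}. (x has_real_derivative x' t) (at t within {0..<T})) \<and>
      continuous_on {0..<T} x' \<and>
      x 0 = M \<and>
      (\<forall>t\<in>{0..<T}. x' t \<le> x t + (x t)\<^sup>2 * exp (integral {0..t} x)) \<and>
      Limsup (at_left T) (\<lambda>t. ereal (x t)) = \<infinity> \<and>
      (\<exists>\<tau>::nat \<Rightarrow> real.
        (\<forall>n. \<tau> n \<in> {0..<T}) \<and>
        filterlim \<tau> (at_left T) sequentially \<and>
        (\<forall>n. x (\<tau> n) = M / (real n + 1))))"
proof -
  define y where "y w = (1 + w) / (M * denom w)" for w
  define y' where "y' w = (denom w - (1 + w) * denom' w) / (M * (denom w)\<^sup>2)" for w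
  have env: "denom w > 0" for w using denom_ge_1[of w] by simp
  have dy: "(y has_real_derivative y' w) (at w)" for w
    unfolding y_def y'_def using env[of w] assms
    by (auto intro!: derivative_eq_intros DERIV_denom simp: field_simps power2_eq_square)
  have cont_env: "continuous_on A denom" for A
    unfolding denom_def by (intro continuous_intros) auto
  have "continuous_on {-3/4..} y"
    using dy DERIV_isCont by (intro continuous_at_imp_continuous_on) blast
  then obtain F where F: "F 0 = 0" "\<And>w. -3/4 < w \<Longrightarrow> (F has_real_derivative y w) (at w)"
    using exists_primitive_greaterThan[of "-3/4" y 0] by auto
  have bdd: "bdd_above (F ` {0..})"
    by (rule primitive_bounded[OF F(2)[unfolded y_def] assms])
  have cy': "continuous_on {-3/4<..} y'"
    unfolding y'_def using assms env
    by (intro continuous_intros cont_env) (auto simp: denom'_def less_imp_neq[symmetric] intro!: continuous_intros)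
  have ineq: "- y' w \<le> exp w * y w" if "0 \<le> w" for w
  proof -
    \<comment> \<open>The term of \<open>- y'\<close> coming from the derivative of
      \<open>1 + w\<close> is negative and is dropped.\<close>
    have "- y' w \<le> (1 + w) * denom' w / (M * (denom w)\<^sup>2)"
      unfolding y'_def minus_divide_left using assms env[of w] by (intro divide_right_mono) auto
    also have "\<dots> \<le> (1 + w) * (exp w * denom w) / (M * (denom w)\<^sup>2)"
    proof (intro divide_right_mono mult_left_mono)
      have "denom' w \<le> exp w * 1" using denom'_le by simp
      also have "\<dots> \<le> exp w * denom w" using denom_ge_1 by (intro mult_left_mono) auto
      finally show "denom' w \<le> exp w * denom w" .
    qed (use that assms in auto)
    also have "\<dots> = exp w * y w"
      using env[of w] assms by (simp add: y_def field_simps power2_eq_square)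
    finally show ?thesis .
  qed
  have pos: "y w > 0" if "-3/4 < w" for w
    unfolding y_def using env[of w] assms that by auto
  obtain T x x' where T: "T > 0"
    and x_pos: "\<And>t. t \<in> {0..<T} \<Longrightarrow> x t > 0"
    and dx: "\<And>t. t \<in> {0..<T} \<Longrightarrow> (x has_real_derivative x' t) (at t)"
    and cx': "continuous_on {0..<T} x'"
    and x_ineq: "\<And>t. t \<in> {0..<T} \<Longrightarrow> x' t \<le> (x t)\<^sup>2 * exp (integral {0..t} x)"
    and F_mem: "\<And>w. w \<ge> 0 \<Longrightarrow> F w \<in> {0..<T}"
    and xF: "\<And>w. w \<ge> 0 \<Longrightarrow> x (F w) = 1 / y w"
    and F_lim: "filterlim F (at_left T) at_top"
    using time_change[of "-3/4" y y' F] pos dy cy' ineq F bdd by auto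
  \<comment> \<open>Shift \<open>a = 0\<close> gives the times with \<open>x = M / (n + 1)\<close>;
    shift \<open>a = 1/2\<close> gives the times along which \<open>x\<close> blows up.\<close>
  have lim: "filterlim (\<lambda>n. F (real n + a)) (at_left T) sequentially" for a
    by (rule filterlim_compose[OF F_lim]) real_asymp
  show ?thesis
  proof (rule exI[of _ T], rule conjI[OF T], rule exI[of _ x], rule exI[of _ x'],
      intro conjI exI[of _ "\<lambda>n. F (real n)"] ballI allI)
    show "x 0 = M" using xF[of 0] F denom_nat[of 0] by (simp add: y_def)
    show "x (F (real n)) = M / (real n + 1)" for n
      using xF[of n] denom_nat[of n] by (simp add: y_def add.commute)
    show "filterlim (\<lambda>n. F (real n)) (at_left T) sequentially" using lim[of 0] by simp
    show "Limsup (at_left T) (\<lambda>t. ereal (x t)) = \<infinity>"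
    proof (rule Limsup_eq_PInf_sequence[OF lim[of "1/2"]])
      have "x (F (real n + 1/2)) = M * (1 + exp (real n + 1/2) / 5) / (real n + 3/2)" for n
        using xF[of "real n + 1/2"] denom_half[of n] by (simp add: y_def add_ac)
      thus "filterlim (\<lambda>n. x (F (real n + 1/2))) at_top sequentially"
        using assms by simp real_asymp
    qed
    show "x' t \<le> x t + (x t)\<^sup>2 * exp (integral {0..t} x)" if "t \<in> {0..<T}" for t
      using x_ineq[OF that] x_pos[OF that] by linarith
  qed (use x_pos dx cx' F_mem in \<open>auto intro: has_field_derivative_at_within\<close>)
qed

end
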